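(* For every permutation $\pi\in\mathcal{S}_n$ ($n\ge1$), $$\mathrm{lbsum}(\pi)=(2\text{-}1)\pi+(1\text{-}\bar4\text{-}3\text{-}\bar4\text{-}2)\pi .$$
   Context: $\mathcal{S}_n$ is the set of permutations $\pi=\pi_1\cdots\pi_n$ of $\{1,\ldots,n\}$. The left border number $a_i$ of $\pi$ is the largest position $m<i$ with $\pi_m>\pi_i$, or $0$ if no such position exists, and $\mathrm{lbsum}(\pi)=a_1+\cdots+a_n$. For a pattern $\sigma$, $(\sigma)\pi$ denotes the number of occurrences of $\sigma$ in $\pi$. Thus $(2\text{-}1)\pi$ is the number of inversions of $\pi$, i.e. of pairs $i<j$ with $\pi_i>\pi_j$. The symbol $1\text{-}\bar4\text{-}3\text{-}\bar4\text{-}2$ denotes a pattern $1\text{-}3\text{-}2$ which is part (in the roles of the letters $1,3,2$) of neither a $1\text{-}4\text{-}3\text{-}2$ nor a $1\text{-}3\text{-}4\text{-}2$ pattern. That is, $(1\text{-}\bar4\text{-}3\text{-}\bar4\text{-}2)\pi$ is the number of triples $i<k<j$ with $\pi_i<\pi_j<\pi_k$ such that there is no position $l$ with $i<l<j$ and $\pi_l>\pi_k$. *)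

theory Defs
  imports "HOL-Combinatorics.Permutations"
begin

text \<open>
  A permutation in \<open>S\<^sub>n\<close> is a function \<open>\<pi>\<close> with \<open>\<pi> permutes {1..n}\<close>; positions and letters
  are counted from 1.
\<close>

definition left_border :: "(nat \<Rightarrow> nat) \<Rightarrow> nat \<Rightarrow> nat" where
  "left_border \<pi> i =
     (let M = {m. 1 \<le> m \<and> m < i \<and> \<pi> m > \<pi> i} in if M = {} then 0 else Max M)"

definition lbsum :: "nat \<Rightarrow> (nat \<Rightarrow> nat) \<Rightarrow> nat" where
  "lbsum n \<pi> = (\<Sum>i=1..n. left_border \<pi> i)"

text \<open>
  An occurrence of a pattern \<open>\<sigma>\<close>, all of whose adjacent letters are separated by dashes, is the
  increasing list of positions of a subsequence of \<open>\<pi>\<close> that is order isomorphic to \<open>\<sigma>\<close>.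
\<close>

definition occurrences :: "nat list \<Rightarrow> nat \<Rightarrow> (nat \<Rightarrow> nat) \<Rightarrow> nat list set" where
  "occurrences \<sigma> n \<pi> =
     {ps. length ps = length \<sigma> \<and> set ps \<subseteq> {1..n} \<and> sorted_wrt (<) ps \<and>
          (\<forall>a<length \<sigma>. \<forall>b<length \<sigma>. \<pi> (ps ! a) < \<pi> (ps ! b) \<longleftrightarrow> \<sigma> ! a < \<sigma> ! b)}"

definition pattern_count :: "nat list \<Rightarrow> nat \<Rightarrow> (nat \<Rightarrow> nat) \<Rightarrow> nat" where
  "pattern_count \<sigma> n \<pi> = card (occurrences \<sigma> n \<pi>)"

text \<open>
  Occurrences of the pattern 1-4-3-4-2 with both letters 4 barred: the occurrences of 1-3-2 that
  play the roles of the letters 1, 3, 2 in no occurrence of 1-4-3-2 and in none of 1-3-4-2.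
\<close>

definition barred_occurrences :: "nat \<Rightarrow> (nat \<Rightarrow> nat) \<Rightarrow> nat list set" where
  "barred_occurrences n \<pi> =
     {ps. \<exists>i k j. ps = [i, k, j] \<and> [i, k, j] \<in> occurrences [1, 3, 2] n \<pi> \<and>
          (\<nexists>l. [i, l, k, j] \<in> occurrences [1, 4, 3, 2] n \<pi>) \<and>
          (\<nexists>l. [i, k, l, j] \<in> occurrences [1, 3, 4, 2] n \<pi>)}"

definition barred_count :: "nat \<Rightarrow> (nat \<Rightarrow> nat) \<Rightarrow> nat" where
  "barred_count n \<pi> = card (barred_occurrences n \<pi>)"

lemma mem_occurrences_21:
  "[i, j] \<in> occurrences [2, 1] n \<pi> \<longleftrightarrow> 1 \<le> i \<and> i < j \<and> j \<le> n \<and> \<pi> i > \<pi> j"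
  by (simp add: occurrences_def numeral_eq_Suc All_less_Suc) linarith

lemma pattern_count_21:
  "pattern_count [2, 1] n \<pi> = card {(i, j). 1 \<le> i \<and> i < j \<and> j \<le> n \<and> \<pi> i > \<pi> j}"
  (is "_ = card ?I")
proof -
  have "bij_betw (\<lambda>(i, j). [i, j]) ?I (occurrences [2, 1] n \<pi>)"
  proof (rule bij_betwI')
    fix ps assume ps: "ps \<in> occurrences [2, 1] n \<pi>"
    then have "length ps = 2" by (simp add: occurrences_def)
    then obtain i j where "ps = [i, j]" by (auto simp: numeral_eq_Suc length_Suc_conv)
    with ps have "(i, j) \<in> ?I" by (simp only: mem_occurrences_21) simp
    then show "\<exists>x\<in>?I. ps = (case x of (i, j) \<Rightarrow> [i, j])"
      by (rule rev_bexI) (simp add: \<open>ps = [i, j]\<close>)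
  qed (auto simp: mem_occurrences_21[simplified])
  then show ?thesis by (simp add: pattern_count_def bij_betw_same_card)
qed

lemma mem_occurrences_132:
  "[i, k, j] \<in> occurrences [1, 3, 2] n \<pi> \<longleftrightarrow>
     1 \<le> i \<and> i < k \<and> k < j \<and> j \<le> n \<and> \<pi> i < \<pi> j \<and> \<pi> j < \<pi> k"
  by (simp add: occurrences_def numeral_eq_Suc All_less_Suc) linarith

lemma mem_occurrences_1432:
  "[i, l, k, j] \<in> occurrences [1, 4, 3, 2] n \<pi> \<longleftrightarrow>
     1 \<le> i \<and> i < l \<and> l < k \<and> k < j \<and> j \<le> n \<and> \<pi> i < \<pi> j \<and> \<pi> j < \<pi> k \<and> \<pi> k < \<pi> l"
  by (simp add: occurrences_def numeral_eq_Suc All_less_Suc) linarith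

lemma mem_occurrences_1342:
  "[i, k, l, j] \<in> occurrences [1, 3, 4, 2] n \<pi> \<longleftrightarrow>
     1 \<le> i \<and> i < k \<and> k < l \<and> l < j \<and> j \<le> n \<and> \<pi> i < \<pi> j \<and> \<pi> j < \<pi> k \<and> \<pi> k < \<pi> l"
  by (simp add: occurrences_def numeral_eq_Suc All_less_Suc) linarith

lemma mem_barred_occurrences:
  "[i, k, j] \<in> barred_occurrences n \<pi> \<longleftrightarrow>
     1 \<le> i \<and> i < k \<and> k < j \<and> j \<le> n \<and> \<pi> i < \<pi> j \<and> \<pi> j < \<pi> k \<and>
     (\<nexists>l. i < l \<and> l < j \<and> \<pi> l > \<pi> k)"
proof -
  have "i < l \<and> l < j \<and> \<pi> l > \<pi> k \<longleftrightarrow>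
          (i < l \<and> l < k \<and> \<pi> k < \<pi> l) \<or> (k < l \<and> l < j \<and> \<pi> k < \<pi> l)" if "i < k" "k < j" for l
    using that by (cases l k rule: linorder_cases) auto
  then show ?thesis
    unfolding barred_occurrences_def mem_occurrences_132 mem_occurrences_1432 mem_occurrences_1342
    by auto
qed

lemma barred_count_eq:
  "barred_count n \<pi> =
     card {(i, k, j). 1 \<le> i \<and> i < k \<and> k < j \<and> j \<le> n \<and> \<pi> i < \<pi> j \<and> \<pi> j < \<pi> k \<and>
                      (\<nexists>l. i < l \<and> l < j \<and> \<pi> l > \<pi> k)}" (is "_ = card ?T")
proof -
  have "bij_betw (\<lambda>(i, k, j). [i, k, j]) ?T (barred_occurrences n \<pi>)"
  proof (rule bij_betwI')
    fix ps assume ps: "ps \<in> barred_occurrences n \<pi>"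
    then obtain i k j where eq: "ps = [i, k, j]" by (auto simp: barred_occurrences_def)
    with ps have "(i, k, j) \<in> ?T" by (simp add: mem_barred_occurrences)
    then show "\<exists>x\<in>?T. ps = (case x of (i, k, j) \<Rightarrow> [i, k, j])"
      by (rule rev_bexI) (simp add: eq)
  qed (auto simp: mem_barred_occurrences)
  then show ?thesis by (simp add: barred_count_def bij_betw_same_card)
qed

end

theory Submission imports Defs begin

text \<open>
  The left border number of the letter at position \<open>j\<close> counts the positions \<open>i \<ge> 1\<close> that have a
  letter larger than \<open>\<pi> j\<close> weakly to their right and before \<open>j\<close>. If \<open>\<pi> i > \<pi> j\<close> this condition
  holds automatically and \<open>(i, j)\<close> is an inversion. If \<open>\<pi> i < \<pi> j\<close>, the position of the largest
  letter strictly between \<open>i\<close> and \<open>j\<close> is the unique \<open>k\<close> that completes \<open>(i, j)\<close> to a barred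
  occurrence \<open>(i, k, j)\<close>.
\<close>

text \<open>A nonzero border is itself a witness \<open>m\<close> and bounds all others;
  \<open>1 \<le> i\<close> excludes the default value 0.\<close>

lemma le_left_border_iff:
  assumes "1 \<le> i"
  shows "i \<le> left_border \<pi> j \<longleftrightarrow> (\<exists>m. i \<le> m \<and> m < j \<and> \<pi> m > \<pi> j)"
proof -
  let ?M = "{m. 1 \<le> m \<and> m < j \<and> \<pi> m > \<pi> j}"
  have "finite ?M" by simp
  then show ?thesis
    using assms by (cases "?M = {}") (auto simp: left_border_def Let_def Max_ge_iff intro: order_trans)
qed

text \<open>Each border number \<open>a\<close> is the size of \<open>{1..a}\<close>, so the sum
  counts pairs.\<close>

lemma lbsum_eq_card:
  "lbsum n \<pi> = card {(i, j). 1 \<le> i \<and> j \<le> n \<and> (\<exists>m. i \<le> m \<and> m < j \<and> \<pi> m > \<pi> j)}"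
    (is "_ = card ?P")
proof -
  have "lbsum n \<pi> = card (SIGMA j:{1..n}. {1..left_border \<pi> j})"
    by (simp add: lbsum_def)
  also have "\<dots> = card (prod.swap ` (SIGMA j:{1..n}. {1..left_border \<pi> j}))"
    by (simp add: card_image)
  also have "prod.swap ` (SIGMA j:{1..n}. {1..left_border \<pi> j}) = ?P"
    by (fastforce simp: le_left_border_iff)
  finally show ?thesis .
qed

lemma bij_betw_barred_triples:
  fixes \<pi> :: "nat \<Rightarrow> nat"
  assumes "inj \<pi>"
  shows "bij_betw (\<lambda>(i, k, j). (i, j))
     {(i, k, j). 1 \<le> i \<and> i < k \<and> k < j \<and> j \<le> n \<and> \<pi> i < \<pi> j \<and> \<pi> j < \<pi> k \<and>
                 (\<nexists>l. i < l \<and> l < j \<and> \<pi> l > \<pi> k)}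
     {(i, j). 1 \<le> i \<and> j \<le> n \<and> \<pi> i < \<pi> j \<and> (\<exists>m. i \<le> m \<and> m < j \<and> \<pi> m > \<pi> j)}"
    (is "bij_betw ?f ?T ?Q")
proof (rule bij_betw_imageI)
  \<comment> \<open>Both \<open>k\<close> and \<open>k'\<close> lie strictly between
    \<open>i\<close> and \<open>j\<close>, so neither letter can exceed the other.\<close>
  have "k = k'" if "(i, k, j) \<in> ?T" "(i, k', j) \<in> ?T" for i k k' j
  proof -
    have "\<pi> k = \<pi> k'" using that by (cases "\<pi> k" "\<pi> k'" rule: linorder_cases) auto
    then show ?thesis using assms by (simp add: inj_eq)
  qed
  then show "inj_on ?f ?T"
    by (fastforce simp: inj_on_def)
next
  show "?f ` ?T = ?Q"
  proof (intro equalityI subsetI)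
    fix p assume "p \<in> ?f ` ?T"
    then show "p \<in> ?Q" by (fastforce intro: less_imp_le)
  next
    fix p assume "p \<in> ?Q"
    then obtain i j m where p: "p = (i, j)" and ij: "1 \<le> i" "j \<le> n" "\<pi> i < \<pi> j"
      and m: "i \<le> m" "m < j" "\<pi> j < \<pi> m" by auto
    \<comment> \<open>\<open>m = i\<close> would contradict
      \<open>\<pi> i < \<pi> j < \<pi> m\<close>; hence the maximum below is over a nonempty
      set.\<close>
    from ij m have m': "m \<in> {i<..<j}" by (cases "i = m") auto
    have "Max (\<pi> ` {i<..<j}) \<in> \<pi> ` {i<..<j}"
      using m' by (intro Max_in) auto
    then obtain k where k: "k \<in> {i<..<j}" "\<pi> k = Max (\<pi> ` {i<..<j})" by auto
    have max: "\<pi> l \<le> \<pi> k" if "l \<in> {i<..<j}" for l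
      using that by (simp add: k(2))
    have "(i, k, j) \<in> ?T"
      using ij k(1) max m(3) max[OF m'] by (force simp: not_less[symmetric])
    then show "p \<in> ?f ` ?T" unfolding p by (rule rev_image_eqI) simp
  qed
qed

theorem proposition1p6:
  fixes n :: nat and \<pi> :: "nat \<Rightarrow> nat"
  assumes "n \<ge> 1" and "\<pi> permutes {1..n}"
  shows "lbsum n \<pi> = pattern_count [2, 1] n \<pi> + barred_count n \<pi>"
proof -
  let ?I = "{(i, j). 1 \<le> i \<and> i < j \<and> j \<le> n \<and> \<pi> i > \<pi> j}"
  let ?Q = "{(i, j). 1 \<le> i \<and> j \<le> n \<and> \<pi> i < \<pi> j \<and> (\<exists>m. i \<le> m \<and> m < j \<and> \<pi> m > \<pi> j)}"
  have inj: "inj \<pi>" using assms(2) by (rule permutes_inj)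
  have split: "{(i, j). 1 \<le> i \<and> j \<le> n \<and> (\<exists>m. i \<le> m \<and> m < j \<and> \<pi> m > \<pi> j)} = ?I \<union> ?Q"
  proof -
    \<comment> \<open>As \<open>i < j\<close>, injectivity leaves only the two strict orders; for an
      inversion, \<open>m = i\<close> is a witness.\<close>
    have "\<pi> i \<noteq> \<pi> j" if "i \<le> m" "m < j" for i m j
      using that inj_eq[OF inj, of i j] by auto
    then show ?thesis by (fastforce simp: neq_iff)
  qed
  have "finite ?I" "finite ?Q"
    by (rule finite_subset[of _ "{1..n} \<times> {1..n}"]; auto)+
  then have "lbsum n \<pi> = card ?I + card ?Q"
    unfolding lbsum_eq_card split by (rule card_Un_disjoint) auto
  also have "card ?Q = barred_count n \<pi>"
    unfolding barred_count_eq using bij_betw_same_card[OF bij_betw_barred_triples[OF inj]] by simp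
  finally show ?thesis by (simp only: pattern_count_21)
qed

end
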